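(* Let $X \subseteq \mathbb{R}^{n_1}$, and let $f:\mathbb{R}^{n_1}\to\mathbb{R}$, $g:\mathbb{R}^{n_1}\to\mathbb{R}^{m_1}$, $\theta:\mathbb{R}^{n_2}\to\mathbb{R}^{m_2}$, $h:\mathbb{R}^{n_1}\to\mathbb{R}^{n_2}$ be functions. Let $$F := \{(x,y)\in\mathbb{R}^{n_1}\times\mathbb{R}^{n_2} : x\in X,\ g(x)\le 0,\ \theta(y)\le 0,\ y=h(x)\},$$ assume that $\min_{(x,y)\in F} f(x)$ is attained, and let $v^*$ be its optimal value. Let $F^+ := \{(x,y,f(x)) : (x,y)\in F\}\subseteq\mathbb{R}^{n_1+n_2+1}$. Let $\{D_N\}_{N=1}^\infty$ be a sequence of data sets, where $D_N=\{x^{(i)} : i=1,\dots,N\}\subseteq X$ consists of $N$ points (depending on $N$), and set $$D_N^+ := \{(x,h(x),f(x)) : x\in D_N\},\qquad F_N^+ := \{(x,y,\phi)\in D_N^+ : (x,y)\in F\}.$$ Suppose that $$\operatorname{conv}(F^+)\subseteq \lim_{N\to\infty}\operatorname{conv}(F_N^+),$$ and define $v_N^* := \min\{\phi : (x,y,\phi)\in\operatorname{conv}(F_N^+)\}$. Then $v^*=\lim_{N\to\infty} v_N^*$.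
   Context: Vector inequalities are component-wise, and $\operatorname{conv}(S)$ denotes the convex hull of $S$. The hypothesis $\operatorname{conv}(F^+)\subseteq \lim_{N\to\infty}\operatorname{conv}(F_N^+)$ means: for every point $z\in\operatorname{conv}(F^+)$ there is a sequence of points $z_N\in\operatorname{conv}(F_N^+)$ (defined for all sufficiently large $N$) with $z_N\to z$. By convention $v_N^*=+\infty$ if $F_N^+$ is empty. The data sets are not assumed to be nested. No convexity or continuity of $X,f,g,\theta,h$ is assumed. *)

theory Defs
  imports "HOL-Analysis.Analysis"
begin

(* The order on real ^ 'n is the component-wise one (less_eq_vec_def). *)

definition feasible ::
  "(real ^ 'n1) set \<Rightarrow> (real ^ 'n1 \<Rightarrow> real ^ 'm1) \<Rightarrow> (real ^ 'n2 \<Rightarrow> real ^ 'm2) \<Rightarrow>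
   ((real ^ 'n1) \<Rightarrow> (real ^ 'n2)) \<Rightarrow> ((real ^ 'n1) \<times> (real ^ 'n2)) set" where
  "feasible X g \<theta> h = {(x, y). x \<in> X \<and> g x \<le> 0 \<and> \<theta> y \<le> 0 \<and> y = h x}"

definition lifted ::
  "((real ^ 'n1) \<Rightarrow> real) \<Rightarrow> ((real ^ 'n1) \<times> (real ^ 'n2)) set \<Rightarrow>
   ((real ^ 'n1) \<times> (real ^ 'n2) \<times> real) set" where
  "lifted f F = {(x, y, f x) | x y. (x, y) \<in> F}"

(* The points are indexed by N as well as by i, so the data sets need not be nested;
   repeated points are allowed. *)
definition data_set :: "(nat \<Rightarrow> nat \<Rightarrow> real ^ 'n1) \<Rightarrow> nat \<Rightarrow> (real ^ 'n1) set" where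
  "data_set p N = {p N i | i. i \<in> {1..N}}"

definition lifted_data ::
  "(real ^ 'n1 \<Rightarrow> real) \<Rightarrow> (real ^ 'n1 \<Rightarrow> real ^ 'n2) \<Rightarrow> (real ^ 'n1) set \<Rightarrow>
   ((real ^ 'n1) \<times> (real ^ 'n2) \<times> real) set" where
  "lifted_data f h D = {(x, h x, f x) | x. x \<in> D}"

definition feasible_data ::
  "((real ^ 'n1) \<times> (real ^ 'n2)) set \<Rightarrow> ((real ^ 'n1) \<Rightarrow> real) \<Rightarrow> ((real ^ 'n1) \<Rightarrow> (real ^ 'n2)) \<Rightarrow>
   (real ^ 'n1) set \<Rightarrow> ((real ^ 'n1) \<times> (real ^ 'n2) \<times> real) set" where
  "feasible_data F f h D = {(x, y, \<phi>). (x, y, \<phi>) \<in> lifted_data f h D \<and> (x, y) \<in> F}"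

definition set_limit :: "(nat \<Rightarrow> 'a::topological_space set) \<Rightarrow> 'a set" where
  "set_limit C = {z. \<exists>\<zeta>. (\<forall>\<^sub>F N in sequentially. \<zeta> N \<in> C N) \<and> \<zeta> \<longlonglongrightarrow> z}"

(* A genuine minimum rather than an infimum: on a nonempty set without a least element
   the value is unspecified. The empty set gets the value infinity. *)
definition min_value :: "real set \<Rightarrow> ereal" where
  "min_value S = (if S = {} then \<infinity> else ereal (LEAST v. v \<in> S))"

end

theory Submission imports Defs begin

text \<open>
  The value of a convex hull in the last coordinate is governed by two facts. From below, every
  point of \<open>F\<^sub>N\<^sup>+\<close> is a lifted feasible point, so its last coordinate is at least \<open>v\<^sup>*\<close>;
  the half-space of points with that property is convex, and so it contains the whole hull of
  \<open>F\<^sub>N\<^sup>+\<close>. From above, the lifted minimiser \<open>(x\<^sup>*, h x\<^sup>*, v\<^sup>*)\<close> lies in \<open>F\<^sup>+\<close>, hence it is a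
  limit of points of the hulls, and their last coordinates dominate \<open>v\<^sub>N\<^sup>*\<close> and tend to
  \<open>v\<^sup>*\<close>. The minima \<open>v\<^sub>N\<^sup>*\<close> are squeezed in between.

  The one analytic point is that \<open>v\<^sub>N\<^sup>*\<close> is a genuine minimum: data sets are finite, so the
  hulls are compact, and they are nonempty for large \<open>N\<close> because the approximating points exist.
  Working with the projection to the last coordinate, which commutes with convex hulls, turns all
  of this into statements about convex hulls of finite sets of real numbers.
\<close>

lemma min_value_eqI:
  assumes "m \<in> S" and "\<And>s. s \<in> S \<Longrightarrow> m \<le> s"
  shows "min_value S = ereal m"
proof -
  have "(LEAST v. v \<in> S) = m"
    using assms by (intro Least_equality)
  then show ?thesis
    using assms(1) by (auto simp: min_value_def)
qed

lemma min_value_compact: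
  assumes "compact S" and "S \<noteq> {}"
  obtains m where "m \<in> S" and "\<And>s. s \<in> S \<Longrightarrow> m \<le> s" and "min_value S = ereal m"
  using compact_attains_inf[OF assms] min_value_eqI[of _ S] by metis

lemma finite_feasible_data:
  "finite (feasible_data F f h (data_set p N))"
proof -
  have "data_set p N = p N ` {1..N}"
    by (auto simp: data_set_def)
  moreover have "feasible_data F f h (data_set p N) \<subseteq> (\<lambda>x. (x, h x, f x)) ` data_set p N"
    by (auto simp: feasible_data_def lifted_data_def)
  ultimately show ?thesis
    by (auto intro: finite_subset)
qed

lemma last_coordinate_convex_hull:
  fixes A :: "('a::real_vector \<times> 'b::real_vector \<times> real) set"
  shows "{\<phi>. \<exists>x y. (x, y, \<phi>) \<in> convex hull A} = convex hull ((\<lambda>z. snd (snd z)) ` A)"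
proof -
  have "linear (\<lambda>z :: 'a \<times> 'b \<times> real. snd (snd z))"
    by (intro linearI) auto
  then have "convex hull ((\<lambda>z. snd (snd z)) ` A) = (\<lambda>z. snd (snd z)) ` (convex hull A)"
    by (rule convex_hull_linear_image[symmetric])
  then show ?thesis
    by force
qed

text \<open>
  The squeeze for finite sets of reals. A bound on the generators passes to the hull because a ray
  is convex; the approximating sequence supplies nonemptiness and the upper bound.
\<close>

lemma tendsto_min_value_convex_hull:
  fixes A :: "nat \<Rightarrow> real set" and a :: real
  assumes fin: "\<And>N. finite (A N)"
    and lower: "\<And>N. A N \<subseteq> {a..}"
    and approx: "a \<in> set_limit (\<lambda>N. convex hull (A N))"
  shows "(\<lambda>N. min_value (convex hull (A N))) \<longlonglongrightarrow> ereal a"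
proof -
  from approx obtain \<zeta>
    where \<zeta>: "\<forall>\<^sub>F N in sequentially. \<zeta> N \<in> convex hull (A N)" and \<zeta>_lim: "\<zeta> \<longlonglongrightarrow> a"
    by (auto simp: set_limit_def)
  have squeeze: "ereal a \<le> min_value (convex hull (A N)) \<and>
      min_value (convex hull (A N)) \<le> ereal (\<zeta> N)"
    if mem: "\<zeta> N \<in> convex hull (A N)" for N
  proof -
    have "compact (convex hull (A N))"
      using fin by (rule finite_imp_compact_convex_hull)
    moreover have "convex hull (A N) \<noteq> {}"
      using mem by blast
    ultimately obtain m where m: "m \<in> convex hull (A N)"
        "\<And>s. s \<in> convex hull (A N) \<Longrightarrow> m \<le> s" "min_value (convex hull (A N)) = ereal m"
      by (rule min_value_compact) auto
    have "convex hull (A N) \<subseteq> {a..}"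
      using lower by (intro hull_minimal) auto
    then show ?thesis
      using m mem by auto
  qed
  show ?thesis
  proof (rule tendsto_sandwich)
    show "\<forall>\<^sub>F N in sequentially. ereal a \<le> min_value (convex hull (A N))"
      using \<zeta> by eventually_elim (use squeeze in blast)
    show "\<forall>\<^sub>F N in sequentially. min_value (convex hull (A N)) \<le> ereal (\<zeta> N)"
      using \<zeta> by eventually_elim (use squeeze in blast)
    show "(\<lambda>N. ereal (\<zeta> N)) \<longlonglongrightarrow> ereal a"
      using \<zeta>_lim by simp
  qed simp
qed

lemma set_limit_image:
  assumes "z \<in> set_limit C" and "isCont \<pi> z"
  shows "\<pi> z \<in> set_limit (\<lambda>N. \<pi> ` C N)"
proof -
  from assms(1) obtain \<zeta> where \<zeta>: "\<forall>\<^sub>F N in sequentially. \<zeta> N \<in> C N" "\<zeta> \<longlonglongrightarrow> z"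
    by (auto simp: set_limit_def)
  have "\<forall>\<^sub>F N in sequentially. \<pi> (\<zeta> N) \<in> \<pi> ` C N"
    using \<zeta>(1) by eventually_elim auto
  moreover have "(\<lambda>N. \<pi> (\<zeta> N)) \<longlonglongrightarrow> \<pi> z"
    using assms(2) \<zeta>(2) by (rule isCont_tendsto_compose)
  ultimately show ?thesis
    by (auto simp: set_limit_def)
qed

theorem proposition2:
  fixes X :: "(real ^ 'n1) set"
    and f :: "real ^ 'n1 \<Rightarrow> real"
    and g :: "real ^ 'n1 \<Rightarrow> real ^ 'm1"
    and \<theta> :: "real ^ 'n2 \<Rightarrow> real ^ 'm2"
    and h :: "real ^ 'n1 \<Rightarrow> real ^ 'n2"
    and p :: "nat \<Rightarrow> nat \<Rightarrow> real ^ 'n1"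
    and F :: "((real ^ 'n1) \<times> (real ^ 'n2)) set"
    and Fplus :: "((real ^ 'n1) \<times> (real ^ 'n2) \<times> real) set"
    and FN :: "nat \<Rightarrow> ((real ^ 'n1) \<times> (real ^ 'n2) \<times> real) set"
    and vstar :: ereal
    and vN :: "nat \<Rightarrow> ereal"
  defines "F \<equiv> feasible X g \<theta> h"
    and "Fplus \<equiv> lifted f F"
    and "FN \<equiv> \<lambda>N. feasible_data F f h (data_set p N)"
    and "vstar \<equiv> min_value {f x | x y. (x, y) \<in> F}"
    and "vN \<equiv> \<lambda>N. min_value {\<phi>. \<exists>x y. (x, y, \<phi>) \<in> convex hull (FN N)}"
  assumes attained: "\<exists>(x, y) \<in> F. \<forall>(x', y') \<in> F. f x \<le> f x'"
    and data: "\<And>N. N \<ge> 1 \<Longrightarrow> data_set p N \<subseteq> X"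
    and limit: "convex hull Fplus \<subseteq> set_limit (\<lambda>N. convex hull (FN N))"
  shows "vN \<longlonglongrightarrow> vstar"
proof -
  let ?\<pi> = "\<lambda>z :: (real ^ 'n1) \<times> (real ^ 'n2) \<times> real. snd (snd z)"
  from attained obtain x0 y0
    where x0: "(x0, y0) \<in> F" and minimal: "\<And>x y. (x, y) \<in> F \<Longrightarrow> f x0 \<le> f x"
    by fastforce
  have vstar: "vstar = ereal (f x0)"
    unfolding vstar_def using x0 minimal by (intro min_value_eqI) auto
  have vN: "vN = (\<lambda>N. min_value (convex hull (?\<pi> ` FN N)))"
    unfolding vN_def by (simp only: last_coordinate_convex_hull)
  have image_hull: "?\<pi> ` (convex hull (FN N)) = convex hull (?\<pi> ` FN N)" for N
    unfolding last_coordinate_convex_hull[symmetric] by force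
  have "(x0, y0, f x0) \<in> convex hull Fplus"
    using x0 unfolding Fplus_def lifted_def by (intro hull_inc) auto
  then have "(x0, y0, f x0) \<in> set_limit (\<lambda>N. convex hull (FN N))"
    using limit by blast
  then have "?\<pi> (x0, y0, f x0) \<in> set_limit (\<lambda>N. ?\<pi> ` (convex hull (FN N)))"
    by (rule set_limit_image) (intro continuous_intros)
  then have approx: "f x0 \<in> set_limit (\<lambda>N. convex hull (?\<pi> ` FN N))"
    by (simp only: image_hull snd_conv)
  have fin: "finite (?\<pi> ` FN N)" for N
    unfolding FN_def by (intro finite_imageI finite_feasible_data)
  have lower: "?\<pi> ` FN N \<subseteq> {f x0..}" for N
    using minimal by (auto simp: FN_def feasible_data_def lifted_data_def)
  have "(\<lambda>N. min_value (convex hull (?\<pi> ` FN N))) \<longlonglongrightarrow> ereal (f x0)"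
    using fin lower approx by (rule tendsto_min_value_convex_hull)
  then show ?thesis
    by (simp only: vN vstar)
qed

end
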